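(* None of the following eight permutation classes is composable: $\mathcal{V}$, $\mathcal{V}^c$, $\mathcal{V}(\mathcal{D},\mathcal{I})$, $\mathcal{V}(\mathcal{I},\mathcal{D})$, $\mathcal{H}$, $\mathcal{H}^c$, $\mathcal{H}(\mathcal{I},\mathcal{D})$, $\mathcal{H}(\mathcal{D},\mathcal{I})$.
   Context: A permutation of order $n$ is a bijection $\pi:[n]\to[n]$, where $[n]=\{1,\dots,n\}$, also viewed as the sequence $\pi(1),\dots,\pi(n)$; the empty permutation (order $0$) is allowed. Two sequences of distinct numbers of the same length are order-isomorphic if their entries are in the same relative order. A permutation $\pi$ is contained in $\sigma$ if $\sigma$ has a (not necessarily contiguous) subsequence order-isomorphic to $\pi$. A permutation class is a set of permutations closed downwards under containment. For permutations of the same order, $(\pi\circ\sigma)(i)=\pi(\sigma(i))$. For permutation classes, $\mathcal{A}\circ\mathcal{B}=\{\pi\circ\varphi : \pi\in\mathcal{A},\varphi\in\mathcal{B},|\pi|=|\varphi|\}$; this is an associative operation on permutation classes. A class $\mathcal{C}$ is $k$-composable if there are permutation classes $\mathcal{C}_1,\dots,\mathcal{C}_k\subsetneq\mathcal{C}$ (repetitions allowed) with $\mathcal{C}\subseteq\mathcal{C}_1\circ\cdots\circ\mathcal{C}_k$; it is composable if it is $k$-composable for some $k\ge2$. $\mathcal{I}$ is the class of all increasing permutations $1,2,\dots,n$, and $\mathcal{D}$ the class of all decreasing permutations $n,\dots,2,1$. The vertical merge $\mathcal{V}(\mathcal{A},\mathcal{B})$ is the class of permutations whose sequence is a concatenation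 $s_1s_2$ of two (possibly empty) sequences with $s_1$ order-isomorphic to a permutation of $\mathcal{A}$ and $s_2$ order-isomorphic to a permutation of $\mathcal{B}$. The horizontal merge $\mathcal{H}(\mathcal{A},\mathcal{B})$ is the class of permutations whose sequence can be partitioned into two (possibly empty) subsequences $s_1,s_2$, order-isomorphic to a permutation of $\mathcal{A}$ and of $\mathcal{B}$ respectively, such that every element (value) of $s_1$ is smaller than every element of $s_2$. $\mathcal{V}=\mathcal{V}(\mathcal{I},\mathcal{I})$ and $\mathcal{H}=\mathcal{H}(\mathcal{I},\mathcal{I})$. For $\pi$ of order $n$, the complement is $\pi^c(k)=n-\pi(k)+1$, and $\mathcal{A}^c=\{\pi^c:\pi\in\mathcal{A}\}$. *)

theory Defs
  imports "HOL-Combinatorics.Multiset_Permutations" "HOL-Library.Sublist"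
begin

text \<open>
  A permutation \<open>\<pi>\<close> of order \<open>n\<close> is the list \<open>[\<pi>(1), \<dots>, \<pi>(n)]\<close>. List positions count from 0 while
  entries are values in \<open>{1..n}\<close>, so \<open>\<pi>(i) = \<pi> ! (i - 1)\<close>.
\<close>

definition is_perm :: "nat list \<Rightarrow> bool" where
  "is_perm p \<longleftrightarrow> p \<in> permutations_of_set {1..length p}"

definition order_iso :: "nat list \<Rightarrow> nat list \<Rightarrow> bool" where
  "order_iso xs ys \<longleftrightarrow> length xs = length ys \<and>
     (\<forall>i<length xs. \<forall>j<length xs. xs ! i < xs ! j \<longleftrightarrow> ys ! i < ys ! j)"

definition contained :: "nat list \<Rightarrow> nat list \<Rightarrow> bool" where
  "contained p q \<longleftrightarrow> (\<exists>s. subseq s q \<and> order_iso s p)"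

definition perm_class :: "nat list set \<Rightarrow> bool" where
  "perm_class C \<longleftrightarrow> (\<forall>p\<in>C. is_perm p) \<and>
     (\<forall>p q. is_perm p \<and> q \<in> C \<and> contained p q \<longrightarrow> p \<in> C)"

definition perm_comp :: "nat list \<Rightarrow> nat list \<Rightarrow> nat list" where
  "perm_comp p q = map (\<lambda>v. p ! (v - 1)) q"

definition class_comp :: "nat list set \<Rightarrow> nat list set \<Rightarrow> nat list set" where
  "class_comp A B = {perm_comp p q | p q. p \<in> A \<and> q \<in> B \<and> length p = length q}"

definition incr_class :: "nat list set" where
  "incr_class = {[1..<Suc n] | n. True}"

definition decr_class :: "nat list set" where
  "decr_class = {rev [1..<Suc n] | n. True}"

text \<open>The value at \<open>[]\<close> is the class of all identity permutations, the unit of \<^const>\<open>class_comp\<close>.\<close>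

fun class_comp_list :: "nat list set list \<Rightarrow> nat list set" where
  "class_comp_list [] = incr_class"
| "class_comp_list [A] = A"
| "class_comp_list (A # B # Cs) = class_comp A (class_comp_list (B # Cs))"

definition k_composable :: "nat \<Rightarrow> nat list set \<Rightarrow> bool" where
  "k_composable k C \<longleftrightarrow>
     (\<exists>Cs. length Cs = k \<and> (\<forall>A\<in>set Cs. perm_class A \<and> A \<subset> C) \<and> C \<subseteq> class_comp_list Cs)"

definition composable :: "nat list set \<Rightarrow> bool" where
  "composable C \<longleftrightarrow> (\<exists>k\<ge>2. k_composable k C)"

definition vmerge :: "nat list set \<Rightarrow> nat list set \<Rightarrow> nat list set" where
  "vmerge A B = {p. is_perm p \<and> (\<exists>s1 s2. p = s1 @ s2 \<and>
     (\<exists>a\<in>A. order_iso s1 a) \<and> (\<exists>b\<in>B. order_iso s2 b))}"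

definition hmerge :: "nat list set \<Rightarrow> nat list set \<Rightarrow> nat list set" where
  "hmerge A B = {p. is_perm p \<and> (\<exists>s1 s2. p \<in> shuffles s1 s2 \<and>
     (\<exists>a\<in>A. order_iso s1 a) \<and> (\<exists>b\<in>B. order_iso s2 b) \<and>
     (\<forall>x\<in>set s1. \<forall>y\<in>set s2. x < y))}"

definition perm_complement :: "nat list \<Rightarrow> nat list" where
  "perm_complement p = map (\<lambda>v. length p - v + 1) p"

definition class_complement :: "nat list set \<Rightarrow> nat list set" where
  "class_complement A = perm_complement ` A"

definition V_class :: "nat list set" where
  "V_class = vmerge incr_class incr_class"

definition H_class :: "nat list set" where
  "H_class = hmerge incr_class incr_class"

end

(*
  A break of a permutation is a pair of consecutive positions whose values are not consecutive.
  Composition is subadditive on the number of breaks, because a break of p o q at i comes either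
  from a break of q at i or from a break of p between the consecutive values q(i), q(i+1).
  In each of the eight classes, a member is coded by a binary word (which of the two merged parts
  each entry lies in), and containment of words implies containment of permutations. A break forces
  an alternation of the word, and a word with 2m alternations contains every word of length m.
  So a member with many breaks contains any given member, i.e. proper subclasses have a bounded
  number of breaks, and so do their compositions; the full classes do not.
*)
theory Submission
  imports Defs
begin

section \<open>Permutations of \<open>{..<n}\<close> as functions: breaks, embeddings and two-part
  splittings\<close>

definition inverse_on :: "nat \<Rightarrow> (nat \<Rightarrow> nat) \<Rightarrow> (nat \<Rightarrow> nat) \<Rightarrow> bool" where
  "inverse_on n \<pi> \<tau> \<longleftrightarrow> (\<forall>i<n. \<pi> i < n \<and> \<tau> i < n \<and> \<tau> (\<pi> i) = i \<and> \<pi> (\<tau> i) = i)"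

definition consec :: "nat \<Rightarrow> nat \<Rightarrow> bool" where
  "consec x y \<longleftrightarrow> y = Suc x \<or> x = Suc y"

definition breaks :: "nat \<Rightarrow> (nat \<Rightarrow> nat) \<Rightarrow> nat" where
  "breaks n \<pi> = card {i. Suc i < n \<and> \<not> consec (\<pi> i) (\<pi> (Suc i))}"

definition embeds :: "nat \<Rightarrow> (nat \<Rightarrow> nat) \<Rightarrow> nat \<Rightarrow> (nat \<Rightarrow> nat) \<Rightarrow> bool" where
  "embeds m \<pi> n \<sigma> \<longleftrightarrow> (\<exists>f. (\<forall>i<m. f i < n) \<and>
     (\<forall>i<m. \<forall>j<m. (i < j \<longleftrightarrow> f i < f j) \<and> (\<pi> i < \<pi> j \<longleftrightarrow> \<sigma> (f i) < \<sigma> (f j))))"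

definition dir_less :: "bool \<Rightarrow> nat \<Rightarrow> nat \<Rightarrow> bool" where
  "dir_less b x y \<longleftrightarrow> (if b then x < y else y < x)"

text \<open>The word coding a member is \<open>\<lambda>i. \<pi> i < t\<close>. The Booleans
  \<open>X\<close> and \<open>Y\<close> are the directions of the lower and the upper part, with
  \<open>True\<close> for increasing.\<close>

definition h_split :: "bool \<Rightarrow> bool \<Rightarrow> nat \<Rightarrow> (nat \<Rightarrow> nat) \<Rightarrow> bool" where
  "h_split X Y n \<pi> \<longleftrightarrow> (\<exists>t. \<forall>i j. i < j \<and> j < n \<longrightarrow>
     (\<pi> i < t \<and> \<pi> j < t \<longrightarrow> dir_less X (\<pi> i) (\<pi> j)) \<and>
     (t \<le> \<pi> i \<and> t \<le> \<pi> j \<longrightarrow> dir_less Y (\<pi> i) (\<pi> j)))"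

text \<open>Here \<open>t\<close> cuts the positions, so the coding word is read along the values,
  that is, along the inverse.\<close>

definition v_split :: "bool \<Rightarrow> bool \<Rightarrow> nat \<Rightarrow> (nat \<Rightarrow> nat) \<Rightarrow> bool" where
  "v_split X Y n \<pi> \<longleftrightarrow> (\<exists>t. \<forall>i j. i < j \<and> j < n \<longrightarrow>
     (j < t \<longrightarrow> dir_less X (\<pi> i) (\<pi> j)) \<and> (t \<le> i \<longrightarrow> dir_less Y (\<pi> i) (\<pi> j)))"

section \<open>Breaks under composition and inversion\<close>

lemma inverse_on_sym: "inverse_on n \<pi> \<tau> \<Longrightarrow> inverse_on n \<tau> \<pi>"
  by (auto simp: inverse_on_def)

lemma inverse_on_inj: "inverse_on n \<pi> \<tau> \<Longrightarrow> i < n \<Longrightarrow> j < n \<Longrightarrow> \<pi> i = \<pi> j \<longleftrightarrow> i = j"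
  by (metis inverse_on_def)

lemma breaks_comp:
  assumes "inverse_on n \<phi> \<psi>"
  shows "breaks n (\<pi> \<circ> \<phi>) \<le> breaks n \<pi> + breaks n \<phi>"
proof -
  let ?P = "{j. Suc j < n \<and> \<not> consec (\<pi> j) (\<pi> (Suc j))}"
  let ?F = "{i. Suc i < n \<and> \<not> consec (\<phi> i) (\<phi> (Suc i))}"
  let ?C = "{i. Suc i < n \<and> \<not> consec ((\<pi> \<circ> \<phi>) i) ((\<pi> \<circ> \<phi>) (Suc i))}"
  have lt: "\<phi> i < n" if "i < n" for i
    using assms that by (auto simp: inverse_on_def)
  \<comment> \<open>A position where \<open>\<pi> \<circ> \<phi>\<close> breaks but
    \<open>\<phi>\<close> does not is charged to the smaller of the two consecutive values of
    \<open>\<phi>\<close>; there \<open>\<pi>\<close> must break.\<close>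
  have "inj_on (\<lambda>i. min (\<phi> i) (\<phi> (Suc i))) (?C - ?F)"
  proof (rule inj_onI)
    fix i j
    assume i: "i \<in> ?C - ?F" and j: "j \<in> ?C - ?F"
      and eq: "min (\<phi> i) (\<phi> (Suc i)) = min (\<phi> j) (\<phi> (Suc j))"
    \<comment> \<open>The smaller of two consecutive values determines the pair. The crossed
      alternative would force \<open>i = Suc j\<close> and \<open>Suc i = j\<close>.\<close>
    have "(\<phi> i = \<phi> j \<and> \<phi> (Suc i) = \<phi> (Suc j)) \<or> (\<phi> i = \<phi> (Suc j) \<and> \<phi> (Suc i) = \<phi> j)"
      using i j eq by (auto simp: consec_def min_def split: if_splits)
    then show "i = j"
      using i j inverse_on_inj[OF assms] by auto
  qed
  moreover have "(\<lambda>i. min (\<phi> i) (\<phi> (Suc i))) ` (?C - ?F) \<subseteq> ?P"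
  proof
    fix v assume "v \<in> (\<lambda>i. min (\<phi> i) (\<phi> (Suc i))) ` (?C - ?F)"
    then obtain i where "i \<in> ?C - ?F" "v = min (\<phi> i) (\<phi> (Suc i))"
      by blast
    then show "v \<in> ?P"
      using lt[of i] lt[of "Suc i"] by (auto simp: consec_def)
  qed
  ultimately have "card (?C - ?F) \<le> card ?P"
    by (rule card_inj_on_le) (auto intro: finite_subset[of _ "{..<n}"])
  moreover have "card ?C \<le> card (?C - ?F) + card ?F"
  proof -
    have fin: "finite ?C" "finite ?F"
      by (rule finite_subset[of _ "{..<n}"]; auto)+
    have "card ?C \<le> card ((?C - ?F) \<union> ?F)"
      using fin by (intro card_mono) auto
    also have "\<dots> \<le> card (?C - ?F) + card ?F"
      by (rule card_Un_le)
    finally show ?thesis .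
  qed
  ultimately show ?thesis
    by (simp add: breaks_def)
qed

text \<open>Inversion turns neighbouring positions with consecutive values into a pair of the same
  kind, so the non-breaks of \<open>\<pi>\<close> inject into those of \<open>\<tau>\<close>. The
  breaks are the rest of the \<open>n - 1\<close> neighbouring pairs. Applied in both directions,
  this gives equality.\<close>

lemma breaks_inverse_le:
  assumes "inverse_on n \<pi> \<tau>"
  shows "breaks n \<tau> \<le> breaks n \<pi>"
proof -
  let ?A = "\<lambda>\<pi>. {i. Suc i < n \<and> consec (\<pi> i) (\<pi> (Suc i))}"
  have br: "breaks n \<rho> + card (?A \<rho>) = n - 1" for \<rho>
  proof -
    have "breaks n \<rho> + card (?A \<rho>)
        = card ({i. Suc i < n \<and> \<not> consec (\<rho> i) (\<rho> (Suc i))} \<union> ?A \<rho>)"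
      unfolding breaks_def
      by (rule card_Un_disjoint[symmetric])
        (auto intro: finite_subset[of _ "{..<n}"])
    also have "{i. Suc i < n \<and> \<not> consec (\<rho> i) (\<rho> (Suc i))} \<union> ?A \<rho> = {..<n-1}"
      by auto
    finally show ?thesis by simp
  qed
  have inj: "inj_on (\<lambda>i. min (\<pi> i) (\<pi> (Suc i))) (?A \<pi>)"
  proof (rule inj_onI)
    fix i j
    assume i: "i \<in> ?A \<pi>" and j: "j \<in> ?A \<pi>"
      and eq: "min (\<pi> i) (\<pi> (Suc i)) = min (\<pi> j) (\<pi> (Suc j))"
    have "(\<pi> i = \<pi> j \<and> \<pi> (Suc i) = \<pi> (Suc j)) \<or> (\<pi> i = \<pi> (Suc j) \<and> \<pi> (Suc i) = \<pi> j)"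
      using i j eq by (auto simp: consec_def min_def split: if_splits)
    then show "i = j"
      using i j inverse_on_inj[OF assms] by auto
  qed
  have sub: "(\<lambda>i. min (\<pi> i) (\<pi> (Suc i))) ` ?A \<pi> \<subseteq> ?A \<tau>"
  proof
    fix v assume "v \<in> (\<lambda>i. min (\<pi> i) (\<pi> (Suc i))) ` ?A \<pi>"
    then obtain i where i: "Suc i < n" "consec (\<pi> i) (\<pi> (Suc i))" "v = min (\<pi> i) (\<pi> (Suc i))"
      by auto
    have "\<pi> i < n" "\<pi> (Suc i) < n" "\<tau> (\<pi> i) = i" "\<tau> (\<pi> (Suc i)) = Suc i"
      using assms i(1) by (auto simp: inverse_on_def)
    then show "v \<in> ?A \<tau>"
      using i(2,3) by (auto simp: consec_def)
  qed
  have "card (?A \<pi>) \<le> card (?A \<tau>)"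
    by (rule card_inj_on_le[OF inj sub]) (auto intro: finite_subset[of _ "{..<n}"])
  then show ?thesis
    using br[of \<pi>] br[of \<tau>] by linarith
qed

section \<open>Inversion exchanges positions and values\<close>

lemma embeds_inverse:
  assumes "inverse_on m \<pi> \<pi>'" "inverse_on n \<sigma> \<sigma>'" "embeds m \<pi>' n \<sigma>'"
  shows "embeds m \<pi> n \<sigma>"
proof -
  obtain f where f: "\<forall>i<m. f i < n" "\<And>i j. i<m \<Longrightarrow> j<m \<Longrightarrow> (i < j \<longleftrightarrow> f i < f j)"
    "\<And>i j. i<m \<Longrightarrow> j<m \<Longrightarrow> (\<pi>' i < \<pi>' j \<longleftrightarrow> \<sigma>' (f i) < \<sigma>' (f j))"
    using assms(3) unfolding embeds_def by blast
  show ?thesis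
    unfolding embeds_def
  \<comment> \<open>The map \<open>f\<close> assigns values of \<open>\<sigma>\<close> to values of
    \<open>\<pi>\<close>, so position \<open>i\<close> has to go to the position at which
    \<open>\<sigma>\<close> takes the value \<open>f (\<pi> i)\<close>.\<close>
  proof (intro exI[of _ "\<lambda>i. \<sigma>' (f (\<pi> i))"] conjI allI impI)
    fix i assume "i < m"
    then show "\<sigma>' (f (\<pi> i)) < n"
      using assms f(1) by (auto simp: inverse_on_def)
  next
    fix i j assume "i < m" "j < m"
    then have *: "\<pi> i < m" "\<pi> j < m" "\<pi>' (\<pi> i) = i" "\<pi>' (\<pi> j) = j"
      "\<sigma> (\<sigma>' (f (\<pi> i))) = f (\<pi> i)" "\<sigma> (\<sigma>' (f (\<pi> j))) = f (\<pi> j)"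
      using assms f(1) by (auto simp: inverse_on_def)
    show "i < j \<longleftrightarrow> \<sigma>' (f (\<pi> i)) < \<sigma>' (f (\<pi> j))"
      using f(3)[of "\<pi> i" "\<pi> j"] * by simp
    show "\<pi> i < \<pi> j \<longleftrightarrow> \<sigma> (\<sigma>' (f (\<pi> i))) < \<sigma> (\<sigma>' (f (\<pi> j)))"
      using f(2)[of "\<pi> i" "\<pi> j"] * by simp
  qed
qed

text \<open>A pair keeps its direction when positions and values are exchanged, so the same
  \<open>t\<close> serves, now as a threshold for values.\<close>

lemma v_split_inverse:
  assumes "inverse_on n \<pi> \<tau>" "v_split X Y n \<pi>"
  shows "h_split X Y n \<tau>"
proof -
  obtain t where t: "\<And>i j. i < j \<Longrightarrow> j < n \<Longrightarrow> j < t \<Longrightarrow> dir_less X (\<pi> i) (\<pi> j)"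
    "\<And>i j. i < j \<Longrightarrow> j < n \<Longrightarrow> t \<le> i \<Longrightarrow> dir_less Y (\<pi> i) (\<pi> j)"
    using assms(2) unfolding v_split_def by blast
  show ?thesis
    unfolding h_split_def
  proof (intro exI[of _ t] allI impI)
    fix i j assume ij: "i < j \<and> j < n"
    then have *: "\<tau> i < n" "\<tau> j < n" "\<pi> (\<tau> i) = i" "\<pi> (\<tau> j) = j"
      using assms(1) by (auto simp: inverse_on_def)
    have ne: "\<tau> i < \<tau> j \<or> \<tau> j < \<tau> i" using * ij by (metis linorder_neqE_nat less_irrefl)
    show "(\<tau> i < t \<and> \<tau> j < t \<longrightarrow> dir_less X (\<tau> i) (\<tau> j)) \<and>
     (t \<le> \<tau> i \<and> t \<le> \<tau> j \<longrightarrow> dir_less Y (\<tau> i) (\<tau> j))"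
      using t[of "\<tau> i" "\<tau> j"] t[of "\<tau> j" "\<tau> i"] * ij ne
      by (auto dest: less_imp_not_less simp: dir_less_def split: if_splits)
  qed
qed

lemma h_split_inverse:
  assumes "inverse_on n \<pi> \<tau>" "h_split X Y n \<pi>"
  shows "v_split X Y n \<tau>"
proof -
  obtain t where t: "\<And>i j. i < j \<Longrightarrow> j < n \<Longrightarrow> \<pi> i < t \<Longrightarrow> \<pi> j < t \<Longrightarrow> dir_less X (\<pi> i) (\<pi> j)"
    "\<And>i j. i < j \<Longrightarrow> j < n \<Longrightarrow> t \<le> \<pi> i \<Longrightarrow> t \<le> \<pi> j \<Longrightarrow> dir_less Y (\<pi> i) (\<pi> j)"
    using assms(2) unfolding h_split_def by blast
  show ?thesis
    unfolding v_split_def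
  proof (intro exI[of _ t] allI impI)
    fix i j assume ij: "i < j \<and> j < n"
    then have *: "\<tau> i < n" "\<tau> j < n" "\<pi> (\<tau> i) = i" "\<pi> (\<tau> j) = j"
      using assms(1) by (auto simp: inverse_on_def)
    have ne: "\<tau> i < \<tau> j \<or> \<tau> j < \<tau> i" using * ij by (metis linorder_neqE_nat less_irrefl)
    show "(j < t \<longrightarrow> dir_less X (\<tau> i) (\<tau> j)) \<and> (t \<le> i \<longrightarrow> dir_less Y (\<tau> i) (\<tau> j))"
      using t[of "\<tau> i" "\<tau> j"] t[of "\<tau> j" "\<tau> i"] * ij ne
      by (auto dest: less_imp_not_less simp: dir_less_def split: if_splits)
  qed
qed

section \<open>Universality of words with many alternations\<close>

text \<open>Two adjacent distinct letters include any required letter. The last alternation of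
  \<open>w\<close> provides the last letter of \<open>u\<close>, and the prefix before it provides
  the others by induction.\<close>

lemma word_embedding:
  fixes w u :: "nat \<Rightarrow> bool"
  assumes "2 * m \<le> card {i. Suc i < n \<and> w i \<noteq> w (Suc i)}"
  shows "\<exists>f. (\<forall>i<m. f i < n \<and> w (f i) = u i) \<and> (\<forall>i j. i < j \<and> j < m \<longrightarrow> f i < f j)"
  using assms
proof (induction m arbitrary: n)
  case 0
  then show ?case by auto
next
  case (Suc m)
  define S where "S n = {i. Suc i < n \<and> w i \<noteq> w (Suc i)}" for n
  have fin: "finite (S n)" for n
    unfolding S_def by (rule finite_subset[of _ "{..<n}"]) auto
  have card: "Suc (Suc (2 * m)) \<le> card (S n)"
    using Suc.prems by (simp add: S_def)
  then have ne: "S n \<noteq> {}" by auto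
  define a where "a = Max (S n)"
  have a: "Suc a < n" "w a \<noteq> w (Suc a)"
    using Max_in[OF fin ne] by (auto simp: a_def S_def)
  \<comment> \<open>Keeping only the prefix of length \<open>a\<close> loses the alternation at
    \<open>a\<close> and possibly the one at \<open>a - 1\<close>; hence the cost of two
    alternations per letter.\<close>
  have "S n \<subseteq> insert a (insert (a - 1) (S a))"
  proof
    fix i assume i: "i \<in> S n"
    then have "i \<le> a" using fin by (simp add: a_def)
    then show "i \<in> insert a (insert (a - 1) (S a))"
      using i by (auto simp: S_def)
  qed
  then have "card (S n) \<le> card (insert a (insert (a - 1) (S a)))"
    using fin by (intro card_mono) auto
  also have "\<dots> \<le> Suc (Suc (card (S a)))"
    using fin by (simp add: card_insert_if)
  finally have "2 * m \<le> card (S a)"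
    using card by simp
  from Suc.IH[OF this[unfolded S_def]] obtain f where f:
    "\<forall>i<m. f i < a \<and> w (f i) = u i" "\<forall>i j. i < j \<and> j < m \<longrightarrow> f i < f j"
    by blast
  define b where "b = (if w a = u m then a else Suc a)"
  have b: "a \<le> b" "b < n" "w b = u m"
    using a by (auto simp: b_def)
  show ?case
  proof (intro exI[of _ "f(m := b)"] conjI allI impI)
    fix i assume "i < Suc m"
    then show "(f(m := b)) i < n" "w ((f(m := b)) i) = u i"
      using f(1) a(1) b by (fastforce simp: less_Suc_eq)+
  next
    fix i j assume "i < j \<and> j < Suc m"
    then show "(f(m := b)) i < (f(m := b)) j"
      using f b(1) by (auto simp: less_Suc_eq)
  qed
qed

text \<open>Once the coding words agree along \<open>f\<close>, the relative order is forced: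
  entries of different parts compare by the threshold, entries of the same part by its
  direction.\<close>

lemma h_split_embeds:
  assumes p: "h_split X Y m \<pi>" "inverse_on m \<pi> \<pi>'"
    and q: "h_split X Y n \<sigma>" "inverse_on n \<sigma> \<sigma>'"
    and breaks: "2 * m \<le> breaks n \<sigma>"
  shows "embeds m \<pi> n \<sigma>"
proof -
  obtain s where s: "\<And>i j. i < j \<Longrightarrow> j < m \<Longrightarrow> \<pi> i < s \<Longrightarrow> \<pi> j < s \<Longrightarrow> dir_less X (\<pi> i) (\<pi> j)"
    "\<And>i j. i < j \<Longrightarrow> j < m \<Longrightarrow> s \<le> \<pi> i \<Longrightarrow> s \<le> \<pi> j \<Longrightarrow> dir_less Y (\<pi> i) (\<pi> j)"
    using p(1) unfolding h_split_def by blast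
  obtain t where t: "\<And>i j. i < j \<Longrightarrow> j < n \<Longrightarrow> \<sigma> i < t \<Longrightarrow> \<sigma> j < t \<Longrightarrow> dir_less X (\<sigma> i) (\<sigma> j)"
    "\<And>i j. i < j \<Longrightarrow> j < n \<Longrightarrow> t \<le> \<sigma> i \<Longrightarrow> t \<le> \<sigma> j \<Longrightarrow> dir_less Y (\<sigma> i) (\<sigma> j)"
    using q(1) unfolding h_split_def by blast
  have alt: "(\<sigma> i < t) \<noteq> (\<sigma> (Suc i) < t)"
    if i: "Suc i < n" "\<not> consec (\<sigma> i) (\<sigma> (Suc i))" for i
  proof
    assume same: "(\<sigma> i < t) = (\<sigma> (Suc i) < t)"
    have lt: "\<sigma> i < n" "\<sigma> (Suc i) < n"
      using q(2) i(1) by (auto simp: inverse_on_def)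
    have neq: "\<sigma> i \<noteq> \<sigma> (Suc i)"
      using inverse_on_inj[OF q(2)] i(1) by auto
    \<comment> \<open>a value strictly between the two entries would sit in the same monotone part,
       hence at a position strictly between \<open>i\<close> and \<open>Suc i\<close>\<close>
    define v where "v = Suc (min (\<sigma> i) (\<sigma> (Suc i)))"
    have v: "min (\<sigma> i) (\<sigma> (Suc i)) < v" "v < max (\<sigma> i) (\<sigma> (Suc i))"
      using i(2) neq by (auto simp: v_def consec_def min_def max_def)
    have "v < n" using v lt by auto
    then obtain k where k: "k < n" "\<sigma> k = v"
      using q(2) by (auto simp: inverse_on_def)
    have k': "k \<noteq> i" "k \<noteq> Suc i"
      using k v by auto
    show False
    proof (cases "\<sigma> i < t")
      case True
      then have "\<sigma> (Suc i) < t" "v < t" using same v by auto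
      then show False
        using t(1)[of i "Suc i"] t(1)[of i k] t(1)[of k i] t(1)[of k "Suc i"] t(1)[of "Suc i" k]
          k k' v i(1) True linorder_less_linear[of i k]
        by (auto simp: dir_less_def not_less_eq less_Suc_eq split: if_splits)
    next
      case False
      then have "t \<le> \<sigma> (Suc i)" "t \<le> v" using same v by auto
      then show False
        using t(2)[of i "Suc i"] t(2)[of i k] t(2)[of k i] t(2)[of k "Suc i"] t(2)[of "Suc i" k]
          k k' v i(1) False linorder_less_linear[of i k]
        by (auto simp: dir_less_def not_less_eq less_Suc_eq split: if_splits)
    qed
  qed
  have "breaks n \<sigma> \<le> card {i. Suc i < n \<and> (\<sigma> i < t) \<noteq> (\<sigma> (Suc i) < t)}"
    unfolding breaks_def using alt
    by (intro card_mono) (auto intro: finite_subset[of _ "{..<n}"])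
  with breaks have "2 * m \<le> card {i. Suc i < n \<and> (\<sigma> i < t) \<noteq> (\<sigma> (Suc i) < t)}"
    by linarith
  from word_embedding[OF this, of "\<lambda>i. \<pi> i < s"] obtain f where
    f: "\<And>i. i < m \<Longrightarrow> f i < n" "\<And>i. i < m \<Longrightarrow> (\<sigma> (f i) < t) = (\<pi> i < s)"
      "\<And>i j. i < j \<Longrightarrow> j < m \<Longrightarrow> f i < f j"
    by blast
  have iso: "\<pi> i < \<pi> j \<longleftrightarrow> \<sigma> (f i) < \<sigma> (f j)" "\<pi> j < \<pi> i \<longleftrightarrow> \<sigma> (f j) < \<sigma> (f i)"
    if ij: "i < j" "j < m" for i j
  proof -
    have "i < m" using ij by simp
    note facts = f(2)[OF \<open>i < m\<close>] f(2)[OF ij(2)] f(1)[OF ij(2)] f(3)[OF ij]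
      s[OF ij] t[of "f i" "f j"]
    show "\<pi> i < \<pi> j \<longleftrightarrow> \<sigma> (f i) < \<sigma> (f j)" "\<pi> j < \<pi> i \<longleftrightarrow> \<sigma> (f j) < \<sigma> (f i)"
      using facts by (cases "\<pi> i < s"; cases "\<pi> j < s"; cases X; cases Y;
          force simp: dir_less_def)+
  qed
  show ?thesis
    unfolding embeds_def
  proof (intro exI[of _ f] conjI allI impI)
    fix i j assume "i < m" "j < m"
    then show "i < j \<longleftrightarrow> f i < f j" "\<pi> i < \<pi> j \<longleftrightarrow> \<sigma> (f i) < \<sigma> (f j)"
      using f(3)[of i j] f(3)[of j i] iso[of i j] iso[of j i]
      by (cases i j rule: linorder_cases; force)+
  qed (use f in auto)
qed

section \<open>Horizontal splittings with arbitrarily many breaks\<close>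

lemma h_split_many_breaks:
  "\<exists>n \<pi> \<tau>. inverse_on n \<pi> \<tau> \<and> h_split X Y n \<pi> \<and> N \<le> breaks n \<pi>"
proof -
  define m where "m = N + 3"
  \<comment> \<open>The word alternates at every position: even positions run through the lower half
    in direction \<open>X\<close>, odd positions through the upper half in direction
    \<open>Y\<close>.\<close>
  define \<pi> where "\<pi> i = (let k = i div 2 in
    if even i then (if X then k else m - 1 - k)
    else (if Y then m + k else 2 * m - 1 - k))" for i
  define \<tau> where "\<tau> v = (if v < m then 2 * (if X then v else m - 1 - v)
    else Suc (2 * (if Y then v - m else 2 * m - 1 - v)))" for v
  \<comment> \<open>If both parts increase, positions \<open>2 * k + 1\<close> and
    \<open>2 * k + 2\<close> carry \<open>m + k\<close> and \<open>k + 1\<close>, at distance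
    \<open>m - 1\<close>; this must be at least 2 for a break.\<close>
  have m: "3 \<le> m" by (simp add: m_def)
  have low: "\<pi> i < m \<longleftrightarrow> even i" if "i < 2 * m" for i
    using that m by (auto simp: \<pi>_def Let_def)
  have "inverse_on (2 * m) \<pi> \<tau>"
    unfolding inverse_on_def
  proof (intro allI impI)
    fix i assume i: "i < 2 * m"
    have 1: "\<pi> i < 2 * m" using i m by (auto simp: \<pi>_def Let_def)
    have 2: "\<tau> i < 2 * m" using i m by (auto simp: \<tau>_def)
    have 3: "\<tau> (\<pi> i) = i"
    proof (cases "even i")
      case True
      then show ?thesis using i low[OF i] by (auto simp: \<tau>_def \<pi>_def Let_def elim!: evenE)
    next
      case False
      then show ?thesis using i low[OF i] by (auto simp: \<tau>_def \<pi>_def Let_def elim!: oddE)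
    qed
    have 4: "\<pi> (\<tau> i) = i"
      using i by (auto simp: \<tau>_def \<pi>_def Let_def)
    show "\<pi> i < 2 * m \<and> \<tau> i < 2 * m \<and> \<tau> (\<pi> i) = i \<and> \<pi> (\<tau> i) = i"
      using 1 2 3 4 by simp
  qed
  moreover have "h_split X Y (2 * m) \<pi>"
    unfolding h_split_def
  proof (intro exI[of _ m] allI impI)
    fix i j assume ij: "i < j \<and> j < 2 * m"
    then have "\<pi> i < m \<longleftrightarrow> even i" "\<pi> j < m \<longleftrightarrow> even j" using low by auto
    then show "(\<pi> i < m \<and> \<pi> j < m \<longrightarrow> dir_less X (\<pi> i) (\<pi> j)) \<and>
      (m \<le> \<pi> i \<and> m \<le> \<pi> j \<longrightarrow> dir_less Y (\<pi> i) (\<pi> j))"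
      using ij by (auto simp: dir_less_def \<pi>_def Let_def not_less[symmetric] elim!: evenE oddE)
  qed
  moreover have "N \<le> breaks (2 * m) \<pi>"
  proof -
    \<comment> \<open>the two parts may touch at the first pair or at the last pair of positions\<close>
    have "{1..<2 * m - 2} \<subseteq> {i. Suc i < 2 * m \<and> \<not> consec (\<pi> i) (\<pi> (Suc i))}"
    proof
      fix i assume i: "i \<in> {1..<2 * m - 2}"
      have "\<not> consec (\<pi> i) (\<pi> (Suc i))"
      proof (cases "even i")
        case True
        then obtain k where "i = 2 * k" by (elim evenE)
        then show ?thesis using i m by (auto simp: consec_def \<pi>_def Let_def)
      next
        case False
        then obtain k where "i = 2 * k + 1" by (elim oddE)
        then show ?thesis using i m by (auto simp: consec_def \<pi>_def Let_def)
      qed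
      then show "i \<in> {i. Suc i < 2 * m \<and> \<not> consec (\<pi> i) (\<pi> (Suc i))}"
        using i by auto
    qed
    then have "card {1..<2 * m - 2} \<le> breaks (2 * m) \<pi>"
      unfolding breaks_def by (intro card_mono) (auto intro: finite_subset[of _ "{..<2 * m}"])
    then show ?thesis by (simp add: m_def)
  qed
  ultimately show ?thesis by blast
qed

section \<open>Transfer to permutations as lists\<close>

text \<open>Positions and values both count from 0, so that inversion exchanges their roles.\<close>

definition pval :: "nat list \<Rightarrow> nat \<Rightarrow> nat" where
  "pval p i = p ! i - 1"

lemma is_perm_iff: "is_perm p \<longleftrightarrow> distinct p \<and> set p = {1..length p}"
  by (auto simp: is_perm_def permutations_of_set_def)

lemma is_perm_nth: "is_perm p \<Longrightarrow> i < length p \<Longrightarrow> 1 \<le> p ! i \<and> p ! i \<le> length p"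
  by (metis atLeastAtMost_iff is_perm_iff nth_mem)

lemma nth_eq_Suc_pval: "is_perm p \<Longrightarrow> i < length p \<Longrightarrow> p ! i = Suc (pval p i)"
  using is_perm_nth[of p i] by (simp add: pval_def)

lemma is_perm_inverse_on:
  assumes "is_perm p"
  obtains \<tau> where "inverse_on (length p) (pval p) \<tau>"
proof -
  have "\<forall>v<length p. \<exists>i<length p. p ! i = Suc v"
  proof (intro allI impI)
    fix v assume "v < length p"
    then have "Suc v \<in> set p" using assms by (simp add: is_perm_iff)
    then show "\<exists>i<length p. p ! i = Suc v" by (simp add: in_set_conv_nth)
  qed
  then obtain \<tau> where \<tau>: "\<And>v. v < length p \<Longrightarrow> \<tau> v < length p \<and> p ! \<tau> v = Suc v"
    by metis
  have "inverse_on (length p) (pval p) \<tau>"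
    unfolding inverse_on_def
  proof (intro allI impI)
    fix i assume i: "i < length p"
    have v: "pval p i < length p" "p ! i = Suc (pval p i)"
      using is_perm_nth[OF assms i] by (auto simp: pval_def)
    have "p ! \<tau> (pval p i) = p ! i" using \<tau>[OF v(1)] v(2) by simp
    then have "\<tau> (pval p i) = i"
      using assms i \<tau>[OF v(1)] nth_eq_iff_index_eq[of p] by (auto simp: is_perm_iff)
    moreover have "pval p (\<tau> i) = i"
      using \<tau>[OF i] by (simp add: pval_def)
    ultimately show "pval p i < length p \<and> \<tau> i < length p \<and> \<tau> (pval p i) = i \<and> pval p (\<tau> i) = i"
      using v(1) \<tau>[OF i] by simp
  qed
  then show thesis by (rule that)
qed

lemma inverse_on_is_perm:
  assumes "inverse_on n \<pi> \<tau>"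
  shows "is_perm (map (\<lambda>i. Suc (\<pi> i)) [0..<n])"
proof -
  have "(\<lambda>i. Suc (\<pi> i)) ` {0..<n} = {1..n}"
  proof
    show "{1..n} \<subseteq> (\<lambda>i. Suc (\<pi> i)) ` {0..<n}"
    proof
      fix v assume v: "v \<in> {1..n}"
      then have "v - 1 < n" by auto
      then have "\<pi> (\<tau> (v - 1)) = v - 1" "\<tau> (v - 1) < n"
        using assms by (auto simp: inverse_on_def)
      then show "v \<in> (\<lambda>i. Suc (\<pi> i)) ` {0..<n}"
        using v by (intro image_eqI[of _ _ "\<tau> (v - 1)"]) auto
    qed
  qed (use assms in \<open>auto simp: inverse_on_def Suc_le_eq\<close>)
  moreover have "inj_on (\<lambda>i. Suc (\<pi> i)) {0..<n}"
    using inverse_on_inj[OF assms] by (auto simp: inj_on_def)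
  ultimately show ?thesis
    by (simp add: is_perm_iff distinct_map)
qed

text \<open>Induction removes the last index: all earlier ones lie below \<open>f m\<close>, so they
  select a subsequence of \<open>take (f m) q\<close>, to which the entry at \<open>f m\<close> is
  appended.\<close>

lemma subseq_map_nth:
  assumes "\<forall>i<m. f i < length q" "\<forall>i j. i < j \<and> j < m \<longrightarrow> f i < f j"
  shows "subseq (map (\<lambda>i. q ! f i) [0..<m]) q"
  using assms
proof (induction m arbitrary: q)
  case 0
  then show ?case by simp
next
  case (Suc m)
  let ?k = "f m"
  have k: "?k < length q" using Suc.prems by auto
  have "subseq (map (\<lambda>i. take ?k q ! f i) [0..<m]) (take ?k q)"
    using Suc.prems k by (intro Suc.IH) auto
  also have "map (\<lambda>i. take ?k q ! f i) [0..<m] = map (\<lambda>i. q ! f i) [0..<m]"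
    using Suc.prems by auto
  finally have "subseq (map (\<lambda>i. q ! f i) [0..<m] @ [q ! ?k]) (take ?k q @ [q ! ?k])"
    by (intro list_emb_append_mono) auto
  also have "subseq (take ?k q @ [q ! ?k]) q"
    using k by (metis take_Suc_conv_app_nth prefix_imp_subseq take_is_prefix)
  finally show ?case by simp
qed

lemma embeds_contained:
  assumes "is_perm p" "is_perm q" "embeds (length p) (pval p) (length q) (pval q)"
  shows "contained p q"
proof -
  obtain f where f: "\<forall>i<length p. f i < length q"
    "\<And>i j. i < length p \<Longrightarrow> j < length p \<Longrightarrow> (i < j \<longleftrightarrow> f i < f j)"
    "\<And>i j. i < length p \<Longrightarrow> j < length p \<Longrightarrow> (pval p i < pval p j \<longleftrightarrow> pval q (f i) < pval q (f j))"
    using assms(3) unfolding embeds_def by blast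
  have "subseq (map (\<lambda>i. q ! f i) [0..<length p]) q"
    using f(1,2) by (intro subseq_map_nth) (metis order.strict_trans)+
  moreover have "order_iso (map (\<lambda>i. q ! f i) [0..<length p]) p"
    unfolding order_iso_def using f(1,3) assms(1,2) by (auto simp: nth_eq_Suc_pval)
  ultimately show ?thesis
    unfolding contained_def by blast
qed

lemma perm_comp_is_perm:
  assumes "is_perm p" "is_perm q" "length p = length q"
  shows "is_perm (perm_comp p q)"
proof -
  have inj: "inj_on (\<lambda>v. p ! (v - 1)) (set q)"
    using assms by (auto simp: inj_on_def is_perm_iff nth_eq_iff_index_eq)
  have "(\<lambda>v. p ! (v - 1)) ` set q = set p"
  proof -
    \<comment> \<open>The entries of \<open>q\<close>, lowered by one, are exactly the list indices
      of \<open>p\<close>.\<close>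
    have "set q = Suc ` {..<length p}"
      using assms by (auto simp: is_perm_iff image_Suc_lessThan)
    then show ?thesis by (auto simp: image_image set_conv_nth)
  qed
  then show ?thesis
    using inj assms by (simp add: is_perm_iff perm_comp_def distinct_map)
qed

section \<open>Bounded breaks in proper subclasses and in their compositions\<close>

abbreviation perm_breaks :: "nat list \<Rightarrow> nat" where
  "perm_breaks p \<equiv> breaks (length p) (pval p)"

lemma breaks_cong: "(\<And>i. i < n \<Longrightarrow> \<pi> i = \<sigma> i) \<Longrightarrow> breaks n \<pi> = breaks n \<sigma>"
  unfolding breaks_def by (metis Suc_lessD)

lemma perm_breaks_comp:
  assumes "is_perm p" "is_perm q" "length p = length q"
  shows "perm_breaks (perm_comp p q) \<le> perm_breaks p + perm_breaks q"
proof -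
  obtain \<tau> where \<tau>: "inverse_on (length q) (pval q) \<tau>"
    using is_perm_inverse_on[OF assms(2)] .
  have "perm_breaks (perm_comp p q) = breaks (length q) (pval p \<circ> pval q)"
    unfolding perm_comp_def length_map
    by (rule breaks_cong) (simp add: pval_def)
  then show ?thesis
    using breaks_comp[OF \<tau>, of "pval p"] assms(3) by simp
qed

text \<open>By subadditivity the bounds of the factors add up. That all members are permutations is
  carried through the induction because subadditivity asks for it.\<close>

lemma class_comp_list_breaks_bounded:
  assumes "Cs \<noteq> []" "\<forall>A\<in>set Cs. (\<forall>p\<in>A. is_perm p) \<and> (\<exists>N. \<forall>p\<in>A. perm_breaks p \<le> N)"
  shows "(\<forall>p\<in>class_comp_list Cs. is_perm p) \<and> (\<exists>N. \<forall>p\<in>class_comp_list Cs. perm_breaks p \<le> N)"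
  using assms
proof (induction Cs rule: class_comp_list.induct)
  case (3 A B Cs)
  let ?R = "class_comp_list (B # Cs)"
  obtain N where N: "\<forall>p\<in>A. perm_breaks p \<le> N" and A: "\<forall>p\<in>A. is_perm p"
    using "3.prems" by auto
  have "(\<forall>p\<in>?R. is_perm p) \<and> (\<exists>N. \<forall>p\<in>?R. perm_breaks p \<le> N)"
    using "3.prems" by (intro "3.IH") simp_all
  then obtain M where M: "\<forall>p\<in>?R. perm_breaks p \<le> M" and R: "\<forall>p\<in>?R. is_perm p"
    by blast
  have "perm_breaks p \<le> N + M \<and> is_perm p" if p: "p \<in> class_comp A ?R" for p
  proof -
    obtain a r where ar: "a \<in> A" "r \<in> ?R" "length a = length r" "p = perm_comp a r"
      using p unfolding class_comp_def by blast
    have "perm_breaks p \<le> perm_breaks a + perm_breaks r"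
      using perm_breaks_comp ar A R by blast
    also have "\<dots> \<le> N + M"
      using N M ar by (intro add_mono) auto
    finally show ?thesis
      using perm_comp_is_perm ar A R by blast
  qed
  then show ?case by (metis class_comp_list.simps(3))
qed auto

text \<open>A proper subclass misses some \<open>p\<close>. Being closed downwards, it has no member
  containing \<open>p\<close>, hence none with many breaks.\<close>

lemma not_composable_if_breaks_unbounded:
  assumes perm: "\<forall>p\<in>C. is_perm p"
    and universal: "\<forall>p\<in>C. \<exists>N. \<forall>q\<in>C. N \<le> perm_breaks q \<longrightarrow> contained p q"
    and unbounded: "\<forall>N. \<exists>q\<in>C. N \<le> perm_breaks q"
  shows "\<not> composable C"
proof
  assume "composable C"
  then obtain Cs where Cs: "length Cs \<ge> 2" "\<forall>A\<in>set Cs. perm_class A \<and> A \<subset> C"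
    "C \<subseteq> class_comp_list Cs"
    unfolding composable_def k_composable_def by blast
  have "\<exists>N. \<forall>p\<in>A. perm_breaks p \<le> N" if A: "A \<in> set Cs" for A
  proof -
    obtain p where p: "p \<in> C" "p \<notin> A" using Cs(2) A by blast
    obtain N where N: "\<forall>q\<in>C. N \<le> perm_breaks q \<longrightarrow> contained p q"
      using universal p(1) by blast
    have "perm_breaks q \<le> N" if q: "q \<in> A" for q
    proof (rule ccontr)
      assume "\<not> perm_breaks q \<le> N"
      moreover have "q \<in> C" using Cs(2) A q by blast
      ultimately have "contained p q" using N by simp
      moreover have "perm_class A" using Cs(2) A by blast
      moreover have "is_perm p" using perm p(1) by blast
      ultimately have "p \<in> A"
        using q unfolding perm_class_def by metis
      then show False using p(2) by simp
    qed
    then show ?thesis by blast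
  qed
  moreover have "\<forall>A\<in>set Cs. \<forall>p\<in>A. is_perm p"
    using Cs(2) perm by blast
  moreover have "Cs \<noteq> []" using Cs(1) by auto
  ultimately obtain N where "\<forall>p\<in>class_comp_list Cs. perm_breaks p \<le> N"
    using class_comp_list_breaks_bounded[of Cs] by blast
  \<comment> \<open>A member of \<open>C\<close> with at least \<open>Suc N\<close> breaks
    contradicts the bound on the composition.\<close>
  then show False
    using unbounded Cs(3) by (metis not_less_eq_eq subsetD)
qed

lemma not_composable_h_split:
  assumes C: "\<And>p. p \<in> C \<longleftrightarrow> is_perm p \<and> h_split X Y (length p) (pval p)"
  shows "\<not> composable C"
proof (rule not_composable_if_breaks_unbounded)
  show "\<forall>p\<in>C. \<exists>N. \<forall>q\<in>C. N \<le> perm_breaks q \<longrightarrow> contained p q"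
    \<comment> \<open>The number of breaks that suffices for \<open>p\<close> is
      \<open>2 * length p\<close>.\<close>
    using C by (meson embeds_contained h_split_embeds is_perm_inverse_on)
  show "\<forall>N. \<exists>q\<in>C. N \<le> perm_breaks q"
  proof
    fix N
    obtain n \<pi> \<tau> where *: "inverse_on n \<pi> \<tau>" "h_split X Y n \<pi>" "N \<le> breaks n \<pi>"
      using h_split_many_breaks by blast
    let ?p = "map (\<lambda>i. Suc (\<pi> i)) [0..<n]"
    \<comment> \<open>The list records \<open>\<pi>\<close> only below \<open>n\<close>;
      \<open>h_split\<close> and \<open>breaks\<close> consult no other arguments.\<close>
    have p: "pval ?p i = \<pi> i" if "i < n" for i
      using that by (simp add: pval_def)
    have "h_split X Y n (pval ?p)"
      using *(2) p unfolding h_split_def by (metis order.strict_trans)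
    moreover have "breaks n (pval ?p) = breaks n \<pi>"
      using p by (rule breaks_cong)
    ultimately show "\<exists>q\<in>C. N \<le> perm_breaks q"
      using C[of ?p] inverse_on_is_perm[OF *(1)] *(3) by (intro bexI[of _ ?p]) auto
  qed
qed (use C in auto)

text \<open>This reduces to the horizontal case through inverses, which keep the number of breaks
  and respect embeddings.\<close>

lemma not_composable_v_split:
  assumes C: "\<And>p. p \<in> C \<longleftrightarrow> is_perm p \<and> v_split X Y (length p) (pval p)"
  shows "\<not> composable C"
proof (rule not_composable_if_breaks_unbounded)
  show "\<forall>p\<in>C. \<exists>N. \<forall>q\<in>C. N \<le> perm_breaks q \<longrightarrow> contained p q"
  proof (intro ballI exI impI)
    fix p q assume pq: "p \<in> C" "q \<in> C" and br: "2 * length p \<le> perm_breaks q"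
    then have perms: "is_perm p" "is_perm q" using C by auto
    obtain \<pi>' where p: "inverse_on (length p) (pval p) \<pi>'"
      using is_perm_inverse_on[OF perms(1)] .
    obtain \<sigma>' where q: "inverse_on (length q) (pval q) \<sigma>'"
      using is_perm_inverse_on[OF perms(2)] .
    have "embeds (length p) \<pi>' (length q) \<sigma>'"
    proof (rule h_split_embeds)
      show "h_split X Y (length p) \<pi>'" "h_split X Y (length q) \<sigma>'"
        using pq C p q v_split_inverse by auto
      show "2 * length p \<le> breaks (length q) \<sigma>'"
        using br breaks_inverse_le[OF inverse_on_sym[OF q]] by linarith
    qed (use p q inverse_on_sym in auto)
    then show "contained p q"
      using embeds_contained perms embeds_inverse p q by blast
  qed
  show "\<forall>N. \<exists>q\<in>C. N \<le> perm_breaks q"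
  proof
    fix N
    obtain n \<pi> \<tau> where *: "inverse_on n \<pi> \<tau>" "h_split X Y n \<pi>" "N \<le> breaks n \<pi>"
      using h_split_many_breaks by blast
    \<comment> \<open>The inverse of a horizontal witness is a vertical one with as many
      breaks.\<close>
    let ?p = "map (\<lambda>i. Suc (\<tau> i)) [0..<n]"
    have p: "pval ?p i = \<tau> i" if "i < n" for i
      using that by (simp add: pval_def)
    have "v_split X Y n (pval ?p)"
      using h_split_inverse[OF *(1,2)] p unfolding v_split_def by (metis order.strict_trans)
    moreover have "breaks n (pval ?p) = breaks n \<tau>"
      using p by (rule breaks_cong)
    moreover have "breaks n \<pi> \<le> breaks n \<tau>"
      using breaks_inverse_le[OF inverse_on_sym[OF *(1)]] .
    ultimately show "\<exists>q\<in>C. N \<le> perm_breaks q"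
      using C[of ?p] inverse_on_is_perm[OF inverse_on_sym[OF *(1)]] *(3)
      by (intro bexI[of _ ?p]) auto
  qed
qed (use C in auto)

section \<open>Merges of monotone classes as splittings\<close>

text \<open>The Boolean is the direction of \<open>dir_less\<close>, so two Booleans parametrise
  every merge considered.\<close>

definition mono_class :: "bool \<Rightarrow> nat list set" where
  "mono_class b = (if b then incr_class else decr_class)"

lemma order_iso_mono_class:
  "(\<exists>a\<in>mono_class b. order_iso s a) \<longleftrightarrow> sorted_wrt (dir_less b) s"
proof
  assume "\<exists>a\<in>mono_class b. order_iso s a"
  then show "sorted_wrt (dir_less b) s"
    by (auto simp: mono_class_def incr_class_def decr_class_def order_iso_def dir_less_def
        sorted_wrt_iff_nth_less rev_nth simp del: upt_Suc split: if_splits)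
next
  assume s: "sorted_wrt (dir_less b) s"
  let ?a = "if b then [1..<Suc (length s)] else rev [1..<Suc (length s)]"
  have "order_iso s ?a"
    unfolding order_iso_def
  proof (intro conjI allI impI)
    fix i j assume ij: "i < length s" "j < length s"
    show "s ! i < s ! j \<longleftrightarrow> ?a ! i < ?a ! j"
      using s ij unfolding sorted_wrt_iff_nth_less
      by (cases i j rule: linorder_cases)
        (fastforce simp: dir_less_def rev_nth simp del: upt_Suc split: if_splits)+
  qed (simp del: upt_Suc)
  moreover have "?a \<in> mono_class b"
    by (auto simp: mono_class_def incr_class_def decr_class_def)
  ultimately show "\<exists>a\<in>mono_class b. order_iso s a" by blast
qed

lemma dir_less_pval:
  assumes "is_perm p" "i < length p" "j < length p"
  shows "dir_less b (p ! i) (p ! j) \<longleftrightarrow> dir_less b (pval p i) (pval p j)"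
  using assms by (simp add: dir_less_def nth_eq_Suc_pval)

lemma sorted_wrt_take_drop:
  "sorted_wrt R (take t p) \<and> sorted_wrt S (drop t p) \<longleftrightarrow>
   (\<forall>i j. i < j \<and> j < length p \<longrightarrow>
     (j < t \<longrightarrow> R (p ! i) (p ! j)) \<and> (t \<le> i \<longrightarrow> S (p ! i) (p ! j)))" (is "?L \<longleftrightarrow> ?R")
proof
  assume L: ?L
  show ?R
  proof (intro allI impI conjI)
    fix i j assume "i < j \<and> j < length p" "j < t"
    then show "R (p ! i) (p ! j)"
      using L by (auto simp: sorted_wrt_iff_nth_less)
  next
    fix i j assume ij: "i < j \<and> j < length p" "t \<le> i"
    then have "i - t < j - t" "j - t < length (drop t p)"
      by auto
    then have "S (drop t p ! (i - t)) (drop t p ! (j - t))"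
      using L unfolding sorted_wrt_iff_nth_less by blast
    then show "S (p ! i) (p ! j)" using ij by simp
  qed
next
  assume ?R
  then show ?L by (auto simp: sorted_wrt_iff_nth_less)
qed

lemma vmerge_iff:
  "p \<in> vmerge (mono_class X) (mono_class Y) \<longleftrightarrow> is_perm p \<and> v_split X Y (length p) (pval p)"
proof -
  have "p \<in> vmerge (mono_class X) (mono_class Y) \<longleftrightarrow> is_perm p \<and>
      (\<exists>s1 s2. p = s1 @ s2 \<and> sorted_wrt (dir_less X) s1 \<and> sorted_wrt (dir_less Y) s2)"
    by (simp add: vmerge_def order_iso_mono_class)
  \<comment> \<open>A concatenation is a cut at \<open>t = length s1\<close>.\<close>
  also have "\<dots> \<longleftrightarrow> is_perm p \<and>
      (\<exists>t. sorted_wrt (dir_less X) (take t p) \<and> sorted_wrt (dir_less Y) (drop t p))"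
    by (metis append_eq_conv_conj append_take_drop_id)
  also have "\<dots> \<longleftrightarrow> is_perm p \<and> v_split X Y (length p) (pval p)"
    unfolding sorted_wrt_take_drop v_split_def
    by (metis dir_less_pval order.strict_trans)
  finally show ?thesis .
qed

text \<open>Moving the filter into the relation lets indices refer to the whole list instead of the
  subsequence.\<close>

lemma sorted_wrt_filter_iff:
  "sorted_wrt R (filter P xs) \<longleftrightarrow> sorted_wrt (\<lambda>x y. P x \<and> P y \<longrightarrow> R x y) xs"
  by (induction xs) auto

lemma hmerge_iff:
  "p \<in> hmerge (mono_class X) (mono_class Y) \<longleftrightarrow> is_perm p \<and> h_split X Y (length p) (pval p)"
proof -
  let ?F = "\<lambda>t. sorted_wrt (dir_less X) (filter (\<lambda>x. x \<le> t) p) \<and>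
    sorted_wrt (dir_less Y) (filter (\<lambda>x. \<not> x \<le> t) p)"
  have "p \<in> hmerge (mono_class X) (mono_class Y) \<longleftrightarrow> is_perm p \<and>
      (\<exists>s1 s2. p \<in> shuffles s1 s2 \<and> sorted_wrt (dir_less X) s1 \<and> sorted_wrt (dir_less Y) s2 \<and>
        (\<forall>x\<in>set s1. \<forall>y\<in>set s2. x < y))"
    by (simp add: hmerge_def order_iso_mono_class)
  also have "\<dots> \<longleftrightarrow> is_perm p \<and> (\<exists>t. ?F t)"
  proof (intro conj_cong refl iffI)
    assume perm: "is_perm p"
      and "\<exists>s1 s2. p \<in> shuffles s1 s2 \<and> sorted_wrt (dir_less X) s1 \<and>
        sorted_wrt (dir_less Y) s2 \<and> (\<forall>x\<in>set s1. \<forall>y\<in>set s2. x < y)"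
    then obtain s1 s2 where s: "p \<in> shuffles s1 s2" "sorted_wrt (dir_less X) s1"
      "sorted_wrt (dir_less Y) s2" "\<forall>x\<in>set s1. \<forall>y\<in>set s2. x < y"
      by blast
    \<comment> \<open>The threshold is the largest value of \<open>s1\<close>. If \<open>s1\<close>
      is empty it is 0, which lies below every value of a permutation.\<close>
    define t where "t = Max (insert 0 (set s1))"
    have low: "\<forall>x\<in>set s1. x \<le> t" by (simp add: t_def)
    have "set s2 \<subseteq> {1..length p}"
      using perm set_shuffles[OF s(1)] unfolding is_perm_iff by blast
    then have "0 < y" if "y \<in> set s2" for y
      using that by auto
    then have high: "\<forall>x\<in>set s2. \<not> x \<le> t"
      using s(4) by (simp add: t_def not_le)
    \<comment> \<open>Filtering commutes with shuffling, and each filter deletes one of the two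
      parts and keeps the other, so the parts are recovered from \<open>p\<close>.\<close>
    have "filter (\<lambda>x. x \<le> t) p \<in> shuffles (filter (\<lambda>x. x \<le> t) s1) (filter (\<lambda>x. x \<le> t) s2)"
      "filter (\<lambda>x. \<not> x \<le> t) p \<in> shuffles (filter (\<lambda>x. \<not> x \<le> t) s1) (filter (\<lambda>x. \<not> x \<le> t) s2)"
      using s(1) filter_shuffles by blast+
    moreover have "filter (\<lambda>x. x \<le> t) s1 = s1" "filter (\<lambda>x. \<not> x \<le> t) s1 = []"
      "filter (\<lambda>x. x \<le> t) s2 = []" "filter (\<lambda>x. \<not> x \<le> t) s2 = s2"
      using low high by (auto simp: filter_id_conv filter_empty_conv)
    ultimately have "filter (\<lambda>x. x \<le> t) p = s1" "filter (\<lambda>x. \<not> x \<le> t) p = s2"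
      by simp_all
    then show "\<exists>t. ?F t" using s(2,3) by (intro exI[of _ t]) simp
  next
    assume "\<exists>t. ?F t"
    then obtain t where "?F t" by blast
    moreover have "p \<in> shuffles (filter (\<lambda>x. x \<le> t) p) (filter (\<lambda>x. \<not> x \<le> t) p)"
      by (rule partition_in_shuffles)
    moreover have "\<forall>x\<in>set (filter (\<lambda>x. x \<le> t) p). \<forall>y\<in>set (filter (\<lambda>x. \<not> x \<le> t) p). x < y"
      by auto
    ultimately show "\<exists>s1 s2. p \<in> shuffles s1 s2 \<and> sorted_wrt (dir_less X) s1 \<and>
        sorted_wrt (dir_less Y) s2 \<and> (\<forall>x\<in>set s1. \<forall>y\<in>set s2. x < y)"
      by blast
  qed
  also have "\<dots> \<longleftrightarrow> is_perm p \<and> h_split X Y (length p) (pval p)"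
  proof (rule conj_cong[OF refl])
    assume p: "is_perm p"
    have "?F t \<longleftrightarrow> (\<forall>i j. i < j \<and> j < length p \<longrightarrow>
      (pval p i < t \<and> pval p j < t \<longrightarrow> dir_less X (pval p i) (pval p j)) \<and>
      (t \<le> pval p i \<and> t \<le> pval p j \<longrightarrow> dir_less Y (pval p i) (pval p j)))"
      (is "_ \<longleftrightarrow> (\<forall>i j. ?Q i j)") for t
    proof -
      have "?F t \<longleftrightarrow> (\<forall>i j. i < j \<and> j < length p \<longrightarrow>
        (p ! i \<le> t \<and> p ! j \<le> t \<longrightarrow> dir_less X (p ! i) (p ! j)) \<and>
        (\<not> p ! i \<le> t \<and> \<not> p ! j \<le> t \<longrightarrow> dir_less Y (p ! i) (p ! j)))"
        (is "_ \<longleftrightarrow> (\<forall>i j. ?P i j)")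
        unfolding sorted_wrt_filter_iff unfolding sorted_wrt_iff_nth_less by (rule iffI; simp)
      moreover have "?P i j \<longleftrightarrow> ?Q i j" for i j
      proof (cases "i < j \<and> j < length p")
        case True
        then have ij: "i < length p" "j < length p" by auto
        \<comment> \<open>Entries exceed \<open>pval\<close> by one, so the weak bound on entries
          becomes a strict bound with the same \<open>t\<close>.\<close>
        have "p ! i \<le> t \<longleftrightarrow> pval p i < t" "p ! j \<le> t \<longleftrightarrow> pval p j < t"
          using nth_eq_Suc_pval[OF p ij(1)] nth_eq_Suc_pval[OF p ij(2)] by auto
        then show ?thesis
          using dir_less_pval[OF p ij] by (simp add: not_less)
      qed blast
      ultimately show ?thesis by simp
    qed
    then show "(\<exists>t. ?F t) \<longleftrightarrow> h_split X Y (length p) (pval p)"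
      unfolding h_split_def by simp
  qed
  finally show ?thesis .
qed

section \<open>Complements\<close>

lemma is_perm_complement:
  assumes "is_perm p"
  shows "is_perm (perm_complement p)"
proof -
  have "set (perm_complement p) = (\<lambda>v. length p - v + 1) ` {1..length p}"
    using assms by (simp add: perm_complement_def is_perm_iff)
  also have "\<dots> = {1..length p}"
  proof
    show "{1..length p} \<subseteq> (\<lambda>v. length p - v + 1) ` {1..length p}"
    proof
      fix v assume "v \<in> {1..length p}"
      \<comment> \<open>Complementation of values is an involution, so the preimage of
        \<open>v\<close> is its own complement.\<close>
      then show "v \<in> (\<lambda>v. length p - v + 1) ` {1..length p}"
        by (intro image_eqI[of _ _ "length p - v + 1"]) auto
    qed
  qed auto
  finally show ?thesis
    using assms by (auto simp: is_perm_iff perm_complement_def distinct_map inj_on_def)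
qed

lemma perm_complement_involution: "is_perm p \<Longrightarrow> perm_complement (perm_complement p) = p"
  by (auto simp: perm_complement_def is_perm_iff intro!: map_idI)

text \<open>The involution turns the image that defines the complement class into a
  preimage.\<close>

lemma class_complement_iff:
  assumes "\<And>p. p \<in> A \<Longrightarrow> is_perm p"
  shows "p \<in> class_complement A \<longleftrightarrow> is_perm p \<and> perm_complement p \<in> A"
  unfolding class_complement_def
  using assms by (metis image_iff is_perm_complement perm_complement_involution)

lemma pval_complement:
  "i < length p \<Longrightarrow> is_perm p \<Longrightarrow> pval (perm_complement p) i = length p - Suc (pval p i)"
  using is_perm_nth[of p i] by (simp add: pval_def perm_complement_def)

text \<open>Values are reversed and positions are not: both directions flip and the cut
  stays.\<close>

lemma v_split_complement:
  assumes "\<And>i. i < n \<Longrightarrow> \<pi> i < n" "\<And>i. i < n \<Longrightarrow> \<sigma> i = n - Suc (\<pi> i)" "v_split X Y n \<pi>"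
  shows "v_split (\<not> X) (\<not> Y) n \<sigma>"
proof -
  have "dir_less (\<not> b) (\<sigma> i) (\<sigma> j)" if "i < j" "j < n" "dir_less b (\<pi> i) (\<pi> j)" for b i j
    using assms(1,2)[of i] assms(1,2)[of j] that by (auto simp: dir_less_def split: if_splits)
  then show ?thesis
    using assms(3) unfolding v_split_def by meson
qed

text \<open>Besides flipping both directions, reversing the values exchanges the lower and the upper
  part, and the threshold becomes \<open>n - t\<close>.\<close>

lemma h_split_complement:
  assumes "\<And>i. i < n \<Longrightarrow> \<pi> i < n" "\<And>i. i < n \<Longrightarrow> \<sigma> i = n - Suc (\<pi> i)" "h_split X Y n \<pi>"
  shows "h_split (\<not> Y) (\<not> X) n \<sigma>"
proof -
  obtain t where t: "\<And>i j. i < j \<Longrightarrow> j < n \<Longrightarrow> \<pi> i < t \<Longrightarrow> \<pi> j < t \<Longrightarrow> dir_less X (\<pi> i) (\<pi> j)"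
    "\<And>i j. i < j \<Longrightarrow> j < n \<Longrightarrow> t \<le> \<pi> i \<Longrightarrow> t \<le> \<pi> j \<Longrightarrow> dir_less Y (\<pi> i) (\<pi> j)"
    using assms(3) unfolding h_split_def by blast
  have dir: "dir_less (\<not> b) (\<sigma> i) (\<sigma> j)" if "i < j" "j < n" "dir_less b (\<pi> i) (\<pi> j)" for b i j
    using assms(1,2)[of i] assms(1,2)[of j] that by (auto simp: dir_less_def split: if_splits)
  have low: "\<sigma> i < n - t \<longleftrightarrow> t \<le> \<pi> i" if "i < n" for i
    using assms(1,2)[OF that] by auto
  show ?thesis
    unfolding h_split_def using t dir low
    by (intro exI[of _ "n - t"]) (metis not_less order.strict_trans)
qed

lemma pval_less: "is_perm p \<Longrightarrow> i < length p \<Longrightarrow> pval p i < length p"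
  using is_perm_nth[of p i] by (auto simp: pval_def)

lemma complement_vmerge_iff:
  "p \<in> class_complement (vmerge (mono_class X) (mono_class Y)) \<longleftrightarrow>
   is_perm p \<and> v_split (\<not> X) (\<not> Y) (length p) (pval p)"
proof -
  have len: "length (perm_complement p) = length p" by (simp add: perm_complement_def)
  have "v_split X Y (length p) (pval (perm_complement p)) \<longleftrightarrow>
      v_split (\<not> X) (\<not> Y) (length p) (pval p)" if p: "is_perm p"
  proof
    assume "v_split X Y (length p) (pval (perm_complement p))"
    \<comment> \<open>\<open>pval p\<close> is in turn the complement of
      \<open>pval (perm_complement p)\<close>, so the one-sided lemma gives this direction
      too.\<close>
    then show "v_split (\<not> X) (\<not> Y) (length p) (pval p)"
      using pval_less[OF p] pval_complement[OF _ p]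
      by (intro v_split_complement[where \<pi> = "pval (perm_complement p)"]) fastforce+
  next
    assume "v_split (\<not> X) (\<not> Y) (length p) (pval p)"
    then show "v_split X Y (length p) (pval (perm_complement p))"
      using v_split_complement[of "length p" "pval p" "pval (perm_complement p)" "\<not> X" "\<not> Y"]
        pval_less[OF p] pval_complement[OF _ p] by simp
  qed
  then show ?thesis
    using class_complement_iff[of "vmerge (mono_class X) (mono_class Y)" p] is_perm_complement[of p]
    by (auto simp: vmerge_iff len)
qed

lemma complement_hmerge_iff:
  "p \<in> class_complement (hmerge (mono_class X) (mono_class Y)) \<longleftrightarrow>
   is_perm p \<and> h_split (\<not> Y) (\<not> X) (length p) (pval p)"
proof -
  have len: "length (perm_complement p) = length p" by (simp add: perm_complement_def)
  have "h_split X Y (length p) (pval (perm_complement p)) \<longleftrightarrow>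
      h_split (\<not> Y) (\<not> X) (length p) (pval p)" if p: "is_perm p"
  proof
    assume "h_split X Y (length p) (pval (perm_complement p))"
    then show "h_split (\<not> Y) (\<not> X) (length p) (pval p)"
      using pval_less[OF p] pval_complement[OF _ p]
      by (intro h_split_complement[where \<pi> = "pval (perm_complement p)"]) fastforce+
  next
    assume "h_split (\<not> Y) (\<not> X) (length p) (pval p)"
    then show "h_split X Y (length p) (pval (perm_complement p))"
      using h_split_complement[of "length p" "pval p" "pval (perm_complement p)" "\<not> Y" "\<not> X"]
        pval_less[OF p] pval_complement[OF _ p] by simp
  qed
  then show ?thesis
    using class_complement_iff[of "hmerge (mono_class X) (mono_class Y)" p] is_perm_complement[of p]
    by (auto simp: hmerge_iff len)
qed

theorem proposition6p4:
  "\<not> composable V_class \<and>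
   \<not> composable (class_complement V_class) \<and>
   \<not> composable (vmerge decr_class incr_class) \<and>
   \<not> composable (vmerge incr_class decr_class) \<and>
   \<not> composable H_class \<and>
   \<not> composable (class_complement H_class) \<and>
   \<not> composable (hmerge incr_class decr_class) \<and>
   \<not> composable (hmerge decr_class incr_class)"
proof -
  have "mono_class True = incr_class" "mono_class False = decr_class"
    by (simp_all add: mono_class_def)
  \<comment> \<open>The facts used stay schematic in \<open>X\<close> and \<open>Y\<close>. Both are
    \<open>True\<close> for \<open>V_class\<close>, \<open>H_class\<close> and their complements;
    the other four classes are the mixed choices.\<close>
  then show ?thesis
    unfolding V_class_def H_class_def
    using not_composable_v_split[OF vmerge_iff] not_composable_v_split[OF complement_vmerge_iff]
      not_composable_h_split[OF hmerge_iff] not_composable_h_split[OF complement_hmerge_iff]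
    by metis
qed

end
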